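(* Let $M,N,K$ be positive integers, $\mathbf A\in\mathbb R^{M\times N}$ with $\mathbf A\neq \mathbf 0$, $\lambda>0$, $c_1=3$, $c_2=\|\mathbf A\|_F$. On $\mathbb R^{M\times K}\times\mathbb R^{K\times N}$ let $g(\mathbf U,\mathbf Z)=\frac12\|\mathbf A-\mathbf U\mathbf Z\|_F^2$, $f=0$, and $$h(\mathbf U,\mathbf Z)=c_1\Big(\tfrac{\|\mathbf U\|_F^2+\|\mathbf Z\|_F^2}{2}\Big)^2+c_2\,\tfrac{\|\mathbf U\|_F^2+\|\mathbf Z\|_F^2}{2}.$$ Then the BPG-MF update $(\mathbf U^{k+1},\mathbf Z^{k+1})$ from $(\mathbf U^k,\mathbf Z^k)$ is given by $$\mathbf U^{k+1}=-r\,\mathbf P^k,\qquad \mathbf Z^{k+1}=-r\,\mathbf Q^k,$$ where $r$ is the non-negative real root of $$c_1\big(\|\mathbf Q^k\|_F^2+\|\mathbf P^k\|_F^2\big)r^3+c_2r-1=0 .$$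
   Context: $\|\cdot\|_F$ and $\langle\cdot,\cdot\rangle$ are the Frobenius norm and inner product. BPG-MF update: given $\lambda>0$, functions $f,g,h$ on $\mathbb R^{M\times K}\times\mathbb R^{K\times N}$ with $g,h$ differentiable, and a current iterate $(\mathbf U^k,\mathbf Z^k)\in\mathbb R^{M\times K}\times\mathbb R^{K\times N}$, put $\mathbf P^k=\lambda\nabla_{\mathbf U}g(\mathbf U^k,\mathbf Z^k)-\nabla_{\mathbf U}h(\mathbf U^k,\mathbf Z^k)$ and $\mathbf Q^k=\lambda\nabla_{\mathbf Z}g(\mathbf U^k,\mathbf Z^k)-\nabla_{\mathbf Z}h(\mathbf U^k,\mathbf Z^k)$; the update is $$(\mathbf U^{k+1},\mathbf Z^{k+1})\in\operatorname*{argmin}_{(\mathbf U,\mathbf Z)\in\mathbb R^{M\times K}\times\mathbb R^{K\times N}}\{\lambda f(\mathbf U,\mathbf Z)+\langle\mathbf P^k,\mathbf U\rangle+\langle\mathbf Q^k,\mathbf Z\rangle+h(\mathbf U,\mathbf Z)\}.$$ *)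

theory Defs
  imports "HOL-Analysis.Analysis"
begin

(* On real ^ 'n ^ 'm (m rows, n columns) the library's norm and inner product are the Frobenius
   ones; the next two lemmas record this. *)

lemma norm_matrix_frobenius:
  fixes A :: "real ^ 'n ^ 'm"
  shows "norm A = sqrt (\<Sum>i\<in>UNIV. \<Sum>j\<in>UNIV. (A $ i $ j)\<^sup>2)"
  by (simp add: norm_vec_def L2_set_def sum_nonneg)

lemma inner_matrix_frobenius:
  fixes A B :: "real ^ 'n ^ 'm"
  shows "A \<bullet> B = (\<Sum>i\<in>UNIV. \<Sum>j\<in>UNIV. A $ i $ j * B $ i $ j)"
  by (simp add: inner_vec_def)

(* Meaningful only where F is differentiable. *)
definition gradient :: "('a::real_inner \<Rightarrow> real) \<Rightarrow> 'a \<Rightarrow> 'a" where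
  "gradient F x = (THE D. GDERIV F x :> D)"

lemma gradient_eqI:
  assumes "GDERIV F x :> D"
  shows "gradient F x = D"
  unfolding gradient_def
proof (rule the_equality[where P = "\<lambda>D. GDERIV F x :> D"])
  fix E assume "GDERIV F x :> E"
  then have "(\<lambda>h. h \<bullet> E) = (\<lambda>h. h \<bullet> D)"
    using assms unfolding gderiv_def by (rule has_derivative_unique)
  then have "h \<bullet> (E - D) = 0" for h
    by (simp add: inner_diff_right fun_eq_iff)
  from this[of "E - D"] show "E = D"
    by simp
qed (rule assms)

definition bpg_P ::
  "real \<Rightarrow> ('a::real_inner \<times> 'b::real_inner \<Rightarrow> real) \<Rightarrow> ('a \<times> 'b \<Rightarrow> real) \<Rightarrow> 'a \<Rightarrow> 'b \<Rightarrow> 'a" where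
  "bpg_P lam g h Uk Zk =
     lam *\<^sub>R gradient (\<lambda>U. g (U, Zk)) Uk - gradient (\<lambda>U. h (U, Zk)) Uk"

definition bpg_Q ::
  "real \<Rightarrow> ('a::real_inner \<times> 'b::real_inner \<Rightarrow> real) \<Rightarrow> ('a \<times> 'b \<Rightarrow> real) \<Rightarrow> 'a \<Rightarrow> 'b \<Rightarrow> 'b" where
  "bpg_Q lam g h Uk Zk =
     lam *\<^sub>R gradient (\<lambda>Z. g (Uk, Z)) Zk - gradient (\<lambda>Z. h (Uk, Z)) Zk"

(* The set of all admissible next iterates, i.e. the full argmin set. *)
definition bpg_mf_update ::
  "real \<Rightarrow> ((real ^ 'k ^ 'm) \<times> (real ^ 'n ^ 'k) \<Rightarrow> real)
    \<Rightarrow> ((real ^ 'k ^ 'm) \<times> (real ^ 'n ^ 'k) \<Rightarrow> real)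
    \<Rightarrow> ((real ^ 'k ^ 'm) \<times> (real ^ 'n ^ 'k) \<Rightarrow> real)
    \<Rightarrow> real ^ 'k ^ 'm \<Rightarrow> real ^ 'n ^ 'k \<Rightarrow> ((real ^ 'k ^ 'm) \<times> (real ^ 'n ^ 'k)) set" where
  "bpg_mf_update lam f g h Uk Zk =
     {x. is_arg_min
           (\<lambda>(U, Z). lam * f (U, Z) + bpg_P lam g h Uk Zk \<bullet> U + bpg_Q lam g h Uk Zk \<bullet> Z + h (U, Z))
           (\<lambda>_. True) x}"

end

theory Submission
  imports Defs
begin

text \<open>
  With \<open>f = 0\<close> the objective of the update is a function of \<open>x = (U, Z)\<close> in one Euclidean
  space, namely \<open>\<Phi> x = p \<bullet> x + c1 * (\<bar>x\<bar>\<^sup>2 / 2)\<^sup>2 + c2 * (\<bar>x\<bar>\<^sup>2 / 2)\<close> with \<open>p = (P, Q)\<close>. A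
  stationary point satisfies \<open>p + (c1 * \<bar>x\<bar>\<^sup>2 + c2) *\<^sub>R x = 0\<close>, so it is a multiple
  \<open>- r *\<^sub>R p\<close>, and the cubic for \<open>r\<close> is what remains of this equation. Its left-hand side is
  strictly increasing on \<open>r \<ge> 0\<close> and changes sign, because \<open>c2 > 0\<close>; hence there is exactly
  one root (\<open>cubic_unique_nonneg_root\<close>).

  That the stationary point is the only minimizer follows without any calculus from
  completing squares: the gap \<open>\<Phi> x - \<Phi> (- r *\<^sub>R p)\<close> is exactly a sum of two squares with
  nonnegative weights, and the first of them has positive weight and vanishes only at
  \<open>x = - r *\<^sub>R p\<close> (\<open>quartic_objective_gap\<close>).
\<close>

lemma cubic_unique_nonneg_root:
  fixes a b :: real
  assumes "0 \<le> a" and "0 < b"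
  shows "\<exists>!r. 0 \<le> r \<and> a * r ^ 3 + b * r - 1 = 0"
proof -
  let ?q = "\<lambda>r. a * r ^ 3 + b * r - 1"
  have "\<exists>r\<ge>0. r \<le> 1 / b \<and> ?q r = 0"
    using assms by (intro IVT') (auto intro!: continuous_intros)
  moreover have "?q r < ?q s" if "0 \<le> r" "r < s" for r s
  proof -
    have "a * r ^ 3 \<le> a * s ^ 3"
      using assms that by (intro mult_left_mono power_mono) auto
    moreover have "b * r < b * s"
      using assms that by simp
    ultimately show ?thesis by simp
  qed
  ultimately show ?thesis
    by (metis less_irrefl linorder_neqE_linordered_idom)
qed

text \<open>
  Put \<open>x0 = - r *\<^sub>R p\<close> and \<open>t = c1 * \<bar>x0\<bar>\<^sup>2 + c2\<close>. The cubic says \<open>t * r = 1\<close>, so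
  \<open>p = - t *\<^sub>R x0\<close>. Writing the linear term \<open>- t * (x0 \<bullet> x)\<close> through \<open>\<bar>x - x0\<bar>\<^sup>2\<close> leaves a
  polynomial in \<open>\<bar>x\<bar>\<^sup>2\<close>, which vanishes to second order at \<open>\<bar>x0\<bar>\<^sup>2\<close> and thus is a square.
\<close>

lemma quartic_objective_gap:
  fixes p x x0 :: "'a::real_inner" and c1 c2 r :: real
  defines "\<Phi> \<equiv> \<lambda>x. p \<bullet> x + c1 * ((norm x)\<^sup>2 / 2)\<^sup>2 + c2 * ((norm x)\<^sup>2 / 2)"
  assumes root: "c1 * (norm p)\<^sup>2 * r ^ 3 + c2 * r - 1 = 0"
    and x0: "x0 = - r *\<^sub>R p"
  shows "\<Phi> x - \<Phi> x0 =
    (c1 * (norm x0)\<^sup>2 + c2) / 2 * (norm (x - x0))\<^sup>2 + c1 / 4 * ((norm x)\<^sup>2 - (norm x0)\<^sup>2)\<^sup>2"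
proof -
  define t where "t = c1 * (norm x0)\<^sup>2 + c2"
  have "t * r = 1"
    using root by (simp add: t_def x0 power_mult_distrib algebra_simps power2_eq_square power3_eq_cube)
  then have p: "p = - t *\<^sub>R x0"
    by (simp add: x0)
  have dist: "(norm (x - x0))\<^sup>2 = (norm x)\<^sup>2 - 2 * (x0 \<bullet> x) + (norm x0)\<^sup>2"
    by (simp add: power2_norm_eq_inner inner_diff inner_commute)
  have lin: "p \<bullet> x = - t * (x0 \<bullet> x)" "p \<bullet> x0 = - t * (norm x0)\<^sup>2"
    by (simp_all add: p power2_norm_eq_inner)
  show ?thesis
    unfolding \<Phi>_def lin dist t_def by (simp add: field_simps power2_eq_square)
qed

lemma quartic_objective_argmin:
  fixes p :: "'a::real_inner" and c1 c2 r :: real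
  assumes "0 \<le> c1" and "0 < c2"
    and root: "c1 * (norm p)\<^sup>2 * r ^ 3 + c2 * r - 1 = 0"
  shows "{x. is_arg_min (\<lambda>x. p \<bullet> x + c1 * ((norm x)\<^sup>2 / 2)\<^sup>2 + c2 * ((norm x)\<^sup>2 / 2))
           (\<lambda>_. True) x} = {- r *\<^sub>R p}"
proof -
  let ?\<Phi> = "\<lambda>x. p \<bullet> x + c1 * ((norm x)\<^sup>2 / 2)\<^sup>2 + c2 * ((norm x)\<^sup>2 / 2)"
  define x0 where "x0 = - r *\<^sub>R p"
  have less: "?\<Phi> x0 < ?\<Phi> x" if "x \<noteq> x0" for x
  proof -
    have "0 < c1 * (norm x0)\<^sup>2 + c2"
      using assms by (intro add_nonneg_pos) auto
    then have "0 < (c1 * (norm x0)\<^sup>2 + c2) / 2 * (norm (x - x0))\<^sup>2"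
      using that by simp
    moreover have "0 \<le> c1 / 4 * ((norm x)\<^sup>2 - (norm x0)\<^sup>2)\<^sup>2"
      using assms by simp
    ultimately show ?thesis
      using quartic_objective_gap[OF root x0_def, of x] by linarith
  qed
  have "is_arg_min ?\<Phi> (\<lambda>_. True) x \<longleftrightarrow> x = x0" for x
    unfolding is_arg_min_def using less by (metis less_asym less_irrefl)
  then show ?thesis
    by (auto simp: x0_def)
qed

theorem propositionC1:
  fixes A :: "real ^ 'n ^ 'm"
    and lam c1 c2 :: real
    and f g h :: "(real ^ 'k ^ 'm) \<times> (real ^ 'n ^ 'k) \<Rightarrow> real"
    and Uk :: "real ^ 'k ^ 'm" and Zk :: "real ^ 'n ^ 'k"
    and P :: "real ^ 'k ^ 'm" and Q :: "real ^ 'n ^ 'k"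
  assumes "A \<noteq> 0"
    and "lam > 0"
    and "c1 = 3"
    and "c2 = norm A"
    and "g = (\<lambda>(U, Z). 1/2 * (norm (A - U ** Z))\<^sup>2)"
    and "f = (\<lambda>_. 0)"
    and "h = (\<lambda>(U, Z). c1 * (((norm U)\<^sup>2 + (norm Z)\<^sup>2) / 2)\<^sup>2
                      + c2 * (((norm U)\<^sup>2 + (norm Z)\<^sup>2) / 2))"
    and "P = bpg_P lam g h Uk Zk"
    and "Q = bpg_Q lam g h Uk Zk"
  shows "(\<exists>!r::real. 0 \<le> r \<and> c1 * ((norm Q)\<^sup>2 + (norm P)\<^sup>2) * r ^ 3 + c2 * r - 1 = 0) \<and>
    (\<forall>r::real. 0 \<le> r \<and> c1 * ((norm Q)\<^sup>2 + (norm P)\<^sup>2) * r ^ 3 + c2 * r - 1 = 0 \<longrightarrow>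
       bpg_mf_update lam f g h Uk Zk = {(- r *\<^sub>R P, - r *\<^sub>R Q)})"
proof -
  have c: "0 \<le> c1" "0 < c2"
    using assms(1,3,4) by simp_all
  have norm_pair: "(norm (X, Y))\<^sup>2 = (norm X)\<^sup>2 + (norm Y)\<^sup>2"
    for X :: "real ^ 'k ^ 'm" and Y :: "real ^ 'n ^ 'k"
    by (simp add: norm_Pair)
  have objective:
    "(\<lambda>(U, Z). lam * f (U, Z) + P \<bullet> U + Q \<bullet> Z + h (U, Z)) =
     (\<lambda>x. (P, Q) \<bullet> x + c1 * ((norm x)\<^sup>2 / 2)\<^sup>2 + c2 * ((norm x)\<^sup>2 / 2))"
    using assms(6,7) by (auto simp: fun_eq_iff norm_pair)
  have update: "bpg_mf_update lam f g h Uk Zk =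
      {x. is_arg_min (\<lambda>x. (P, Q) \<bullet> x + c1 * ((norm x)\<^sup>2 / 2)\<^sup>2 + c2 * ((norm x)\<^sup>2 / 2))
        (\<lambda>_. True) x}"
    unfolding bpg_mf_update_def assms(8,9)[symmetric] objective ..
  have "bpg_mf_update lam f g h Uk Zk = {(- r *\<^sub>R P, - r *\<^sub>R Q)}"
    if "c1 * ((norm Q)\<^sup>2 + (norm P)\<^sup>2) * r ^ 3 + c2 * r - 1 = 0" for r
    unfolding update
    using quartic_objective_argmin[OF c, of "(P, Q)" r] that
    by (simp add: norm_pair add.commute)
  then show ?thesis
    using cubic_unique_nonneg_root[of "c1 * ((norm Q)\<^sup>2 + (norm P)\<^sup>2)" c2] c by simp
qed

end
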